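(* Let $(X,\sigma)$ be a two-sided subshift over a finite alphabet $\mathcal A$. Let $g,h:X\to\mathbb R$ be continuous functions with $h(x)<0$ for all $x\in X$, and let $t\in\mathbb R$ be the unique root of $P_X(\sigma,g+th)=0$, where $P_X(\sigma,\cdot)$ denotes topological pressure. Then $$\lim_{r\to0}\frac{\log\Gamma_r}{\log r}=0,\qquad\text{where}\quad \Gamma_r=\sum_{I\in\mathcal A_r}\ \sup_{x\in[I]\cap X}\exp\big(S_{|I|}(g+th)(x)\big)$$ and, for $r>0$, $$\mathcal A_r=\Big\{i_0\dots i_{n-1}\in X^*:\sup_{x\in[i_0\dots i_{n-1}]\cap X}\exp(S_nh(x))<r\le\sup_{y\in[i_0\dots i_{n-2}]\cap X}\exp(S_{n-1}h(y))\Big\}.$$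
   Context: Two-sided subshift: let $\mathcal A=\{1,\dots,l\}$, let $\mathcal A^{\mathbb Z}$ carry the metric $d(w,w')=\sum_{j\in\mathbb Z}e^{-|j|}|i_j-i'_j|$ for $w=(i_j)$, $w'=(i'_j)$, and the shift $(\sigma w)_j=i_{j+1}$; $X\subset\mathcal A^{\mathbb Z}$ is nonempty, compact, with $\sigma X=X$. $S_n\psi=\sum_{k=0}^{n-1}\psi\circ\sigma^k$ (and $S_0\psi=0$). $X^*$ is the set of finite words allowed in $X$. For a word $I=i_0\dots i_{n-1}$, $|I|=n$ and $[I]$ is the cylinder of sequences whose coordinates at positions $0,\dots,n-1$ are $i_0,\dots,i_{n-1}$ (the cylinder of the empty word is the whole space). $P_X(\sigma,\psi)$ is the usual topological pressure of a continuous $\psi:X\to\mathbb R$: $P_X(\sigma,\psi)=\lim_{\varepsilon\to0}\limsup_{n\to\infty}\frac1n\log\sup\{\sum_{x\in E}e^{S_n\psi(x)}:E\subset X\ (n,\varepsilon)\text{-separated}\}$, where $E$ is $(n,\varepsilon)$-separated if $\max_{0\le k<n}d(\sigma^kx,\sigma^ky)>\varepsilon$ for distinct $x,y\in E$. *)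

theory Defs
  imports "HOL-Analysis.Analysis"
begin

text \<open>The alphabet is \<open>{1..l}\<close>; bi-infinite sequences are functions \<open>int \<Rightarrow> nat\<close>.\<close>

definition full_shift :: "nat \<Rightarrow> (int \<Rightarrow> nat) set" where
  "full_shift l = {w. \<forall>j. w j \<in> {1..l}}"

definition seq_dist :: "(int \<Rightarrow> nat) \<Rightarrow> (int \<Rightarrow> nat) \<Rightarrow> real" where
  "seq_dist w w' = (\<Sum>\<^sub>\<infinity>j\<in>UNIV. exp (- \<bar>real_of_int j\<bar>) * \<bar>real (w j) - real (w' j)\<bar>)"

lemma summable_exp_neg_abs_int:
  "(\<lambda>j::int. exp (- \<bar>real_of_int j\<bar>)) summable_on UNIV"
proof -
  let ?f = "\<lambda>j::int. exp (- \<bar>real_of_int j\<bar>)"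
  have "summable (\<lambda>n. exp (- 1 :: real) ^ n)"
    by (rule summable_geometric) simp
  then have geo: "(\<lambda>n. exp (- real n)) summable_on (A :: nat set)" for A
    by (intro summable_on_subset_banach[OF norm_summable_imp_summable_on, of _ A])
      (simp_all add: exp_of_nat_mult[symmetric])
  have "?f summable_on (int ` UNIV)"
    using geo by (subst summable_on_reindex) (auto simp: o_def)
  moreover have "?f summable_on ((\<lambda>n. - int n) ` {1..})"
    using geo by (subst summable_on_reindex) (auto simp: o_def inj_on_def)
  ultimately have "?f summable_on (int ` UNIV \<union> (\<lambda>n. - int n) ` {1..})"
    by (intro summable_on_Un_disjoint) auto
  moreover have "j \<in> int ` UNIV \<union> (\<lambda>n. - int n) ` {1..}" for j :: int
  proof (cases "0 \<le> j")
    case True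
    then show ?thesis by (metis UnI1 rangeI zero_le_imp_eq_int)
  next
    case False
    then have "j = - int (nat (- j))" "nat (- j) \<in> {1..}" by auto
    then show ?thesis by blast
  qed
  then have "int ` UNIV \<union> (\<lambda>n. - int n) ` {1..} = (UNIV :: int set)" by blast
  ultimately show ?thesis by simp
qed

lemma summable_seq_dist:
  assumes "w \<in> full_shift l" "w' \<in> full_shift l"
  shows "(\<lambda>j. exp (- \<bar>real_of_int j\<bar>) * \<bar>real (w j) - real (w' j)\<bar>) summable_on UNIV"
proof (rule summable_on_comparison_test)
  show "(\<lambda>j::int. exp (- \<bar>real_of_int j\<bar>) * real l) summable_on UNIV"
    by (intro summable_on_cmult_left summable_exp_neg_abs_int)
  fix j :: int
  have "w j \<le> l" "w' j \<le> l" using assms by (auto simp: full_shift_def)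
  then show "exp (- \<bar>real_of_int j\<bar>) * \<bar>real (w j) - real (w' j)\<bar> \<le> exp (- \<bar>real_of_int j\<bar>) * real l"
    by (intro mult_left_mono) auto
qed simp

lemma Metric_space_seq_dist: "Metric_space (full_shift l) seq_dist"
proof
  fix x y z :: "int \<Rightarrow> nat"
  let ?t = "\<lambda>x y (j::int). exp (- \<bar>real_of_int j\<bar>) * \<bar>real (x j) - real (y j)\<bar>"
  show "0 \<le> seq_dist x y"
    unfolding seq_dist_def by (rule infsum_nonneg) simp
  show "seq_dist x y = seq_dist y x"
    by (simp add: seq_dist_def abs_minus_commute)
  show "seq_dist x y = 0 \<longleftrightarrow> x = y" if "x \<in> full_shift l" "y \<in> full_shift l"
  proof
    assume 0: "seq_dist x y = 0"
    have "?t x y j = 0" for j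
      using 0 by (intro nonneg_infsum_le_0D[OF _ summable_seq_dist[OF that]])
        (auto simp: seq_dist_def)
    then show "x = y" by (auto simp: fun_eq_iff)
  qed (simp add: seq_dist_def)
  assume m: "x \<in> full_shift l" "y \<in> full_shift l" "z \<in> full_shift l"
  have "seq_dist x z \<le> (\<Sum>\<^sub>\<infinity>j\<in>UNIV. ?t x y j + ?t y z j)"
    unfolding seq_dist_def
    by (intro infsum_mono summable_on_add summable_seq_dist[of _ l] m)
      (simp flip: distrib_left)
  also have "\<dots> = seq_dist x y + seq_dist y z"
    unfolding seq_dist_def
    by (intro infsum_add summable_seq_dist[of _ l] m)
  finally show "seq_dist x z \<le> seq_dist x y + seq_dist y z" .
qed

definition seq_topology :: "nat \<Rightarrow> (int \<Rightarrow> nat) topology" where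
  "seq_topology l = Metric_space.mtopology (full_shift l) seq_dist"

definition shift :: "(int \<Rightarrow> nat) \<Rightarrow> (int \<Rightarrow> nat)" where
  "shift w = (\<lambda>j. w (j + 1))"

definition two_sided_subshift :: "nat \<Rightarrow> (int \<Rightarrow> nat) set \<Rightarrow> bool" where
  "two_sided_subshift l X \<longleftrightarrow>
     X \<subseteq> full_shift l \<and> X \<noteq> {} \<and> compactin (seq_topology l) X \<and> shift ` X = X"

definition birkhoff_sum :: "nat \<Rightarrow> ((int \<Rightarrow> nat) \<Rightarrow> real) \<Rightarrow> (int \<Rightarrow> nat) \<Rightarrow> real" where
  "birkhoff_sum n \<psi> x = (\<Sum>k<n. \<psi> ((shift ^^ k) x))"

definition separated :: "nat \<Rightarrow> real \<Rightarrow> (int \<Rightarrow> nat) set \<Rightarrow> bool" where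
  "separated n \<epsilon> E \<longleftrightarrow>
     (\<forall>x\<in>E. \<forall>y\<in>E. x \<noteq> y \<longrightarrow> (\<exists>k<n. seq_dist ((shift ^^ k) x) ((shift ^^ k) y) > \<epsilon>))"

text \<open>
  For compact \<open>X\<close> and \<open>\<epsilon> > 0\<close> every separated subset of \<open>X\<close> is finite and their cardinalities are
  bounded for each \<open>n\<close>, so the real supremum below is over a bounded set and requiring
  \<open>finite E\<close> excludes nothing.
  The expression under \<open>Lim\<close> is antimono in \<open>\<epsilon>\<close>, so that the limit exists in \<open>ereal\<close>.
\<close>

definition pressure :: "(int \<Rightarrow> nat) set \<Rightarrow> ((int \<Rightarrow> nat) \<Rightarrow> real) \<Rightarrow> ereal" where
  "pressure X \<psi> =
     Lim (at_right 0) (\<lambda>\<epsilon>. limsup (\<lambda>n. ereal (1 / real n *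
       ln (SUP E \<in> {E. E \<subseteq> X \<and> finite E \<and> separated n \<epsilon> E}.
             \<Sum>x\<in>E. exp (birkhoff_sum n \<psi> x)))))"

definition allowed_words :: "(int \<Rightarrow> nat) set \<Rightarrow> nat list set" where
  "allowed_words X = {w. \<exists>x\<in>X. \<exists>m::int. \<forall>j<length w. x (m + int j) = w ! j}"

definition cylinder :: "nat list \<Rightarrow> (int \<Rightarrow> nat) set" where
  "cylinder w = {x. \<forall>j<length w. x (int j) = w ! j}"

definition cut_words ::
    "(int \<Rightarrow> nat) set \<Rightarrow> ((int \<Rightarrow> nat) \<Rightarrow> real) \<Rightarrow> real \<Rightarrow> nat list set" where
  "cut_words X h r = {w \<in> allowed_words X. w \<noteq> [] \<and>
     (SUP x \<in> cylinder w \<inter> X. exp (birkhoff_sum (length w) h x)) < r \<and>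
     r \<le> (SUP y \<in> cylinder (butlast w) \<inter> X. exp (birkhoff_sum (length w - 1) h y))}"

text \<open>
  For \<open>h\<close> negative and continuous on compact \<open>X\<close> and \<open>r > 0\<close>, the lengths of the words in
  \<open>cut_words X h r\<close> are bounded, so the index set of the following sum is finite.
\<close>

definition Gamma_sum ::
    "(int \<Rightarrow> nat) set \<Rightarrow> ((int \<Rightarrow> nat) \<Rightarrow> real) \<Rightarrow> ((int \<Rightarrow> nat) \<Rightarrow> real) \<Rightarrow> real \<Rightarrow> real \<Rightarrow> real" where
  "Gamma_sum X g h t r =
     (\<Sum>w\<in>cut_words X h r.
        SUP x \<in> cylinder w \<inter> X. exp (birkhoff_sum (length w) (\<lambda>x. g x + t * h x) x))"

end

theory Submission
  imports Defs
begin

text \<open>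
  Write \<open>f = g + t * h\<close>, let \<open>W w\<close> (\<open>word_weight\<close>) be the supremum of
  \<open>exp (birkhoff_sum (length w) f)\<close> over the points of \<open>X\<close> in the cylinder of \<open>w\<close>, and let \<open>Z n\<close>
  (\<open>partition_sum\<close>) be the sum of \<open>W w\<close> over the allowed words of length \<open>n\<close>. For a subshift the
  pressure of \<open>f\<close> is the exponential growth rate of \<open>Z\<close> (\<open>pressure_eq_partition_growth\<close>), so here
  \<open>Z\<close> grows with rate \<open>0\<close>. Both estimates of \<open>\<Gamma>\<^sub>r\<close>, the sum of \<open>W\<close> over the words cut at level
  \<open>r\<close> (\<open>cut_words X h r\<close>), follow from this rate.

  Upper estimate. Since \<open>h \<le> - c < 0\<close> on the compact set \<open>X\<close>, a word cut at level \<open>r\<close> has length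
  at most \<open>N = - ln r / c + O(1)\<close>. Hence \<open>\<Gamma>\<^sub>r\<close> is at most \<open>\<Sum>n\<le>N. Z n\<close>, which is subexponential in
  \<open>N\<close>, that is, eventually smaller than any fixed negative power of \<open>r\<close>.

  Lower estimate. For \<open>r < 1\<close> one even has \<open>\<Gamma>\<^sub>r \<ge> 1\<close>
  (\<open>complete_prefix_set_weight_ge_1\<close>). Every long allowed word starts with a word cut at level
  \<open>r\<close>, and \<open>W (u @ v) \<le> W u * W v\<close>; decomposing long words into cut words therefore would make
  \<open>Z\<close> decay exponentially if \<open>\<Gamma>\<^sub>r < 1\<close>, and the pressure would be negative.

  Thus \<open>ln \<Gamma>\<^sub>r\<close> is nonnegative and of smaller order than \<open>- ln r\<close>.
\<close>

section \<open>Shift and Birkhoff sums\<close>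

lemma shift_funpow: "(shift ^^ k) x = (\<lambda>j. x (j + int k))"
  by (induction k) (auto simp: shift_def algebra_simps)

lemma birkhoff_sum_add:
  "birkhoff_sum (m + n) f x = birkhoff_sum m f x + birkhoff_sum n f ((shift ^^ m) x)"
proof -
  have "birkhoff_sum (m + n) f x
    = (\<Sum>k<m. f ((shift ^^ k) x)) + (\<Sum>k\<in>{m..<m+n}. f ((shift ^^ k) x))"
    unfolding birkhoff_sum_def
    by (simp add: lessThan_atLeast0 sum.atLeastLessThan_concat)
  also have "(\<Sum>k\<in>{m..<m+n}. f ((shift ^^ k) x)) = (\<Sum>k<n. f ((shift ^^ (k + m)) x))"
    using sum.shift_bounds_nat_ivl[of "\<lambda>k. f ((shift ^^ k) x)" 0 m n]
    by (simp add: lessThan_atLeast0 add.commute)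
  finally show ?thesis
    by (simp add: birkhoff_sum_def funpow_add)
qed

lemma cylinder_append:
  "x \<in> cylinder (u @ v) \<longleftrightarrow> x \<in> cylinder u \<and> (shift ^^ length u) x \<in> cylinder v"
proof
  assume x: "x \<in> cylinder (u @ v)"
  show "x \<in> cylinder u \<and> (shift ^^ length u) x \<in> cylinder v"
  proof
    show "x \<in> cylinder u"
      unfolding cylinder_def
    proof (intro CollectI allI impI)
      fix j assume "j < length u"
      then show "x (int j) = u ! j"
        using x[unfolded cylinder_def, simplified, rule_format, of j] by (simp add: nth_append)
    qed
    show "(shift ^^ length u) x \<in> cylinder v"
      unfolding cylinder_def shift_funpow
    proof (intro CollectI allI impI)
      fix j assume "j < length v"
      then show "x (int j + int (length u)) = v ! j"
        using x[unfolded cylinder_def, simplified, rule_format, of "length u + j"]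
        by (simp add: nth_append add.commute)
    qed
  qed
next
  assume "x \<in> cylinder u \<and> (shift ^^ length u) x \<in> cylinder v"
  then have u: "\<And>j. j < length u \<Longrightarrow> x (int j) = u ! j"
    and v: "\<And>j. j < length v \<Longrightarrow> x (int j + int (length u)) = v ! j"
    by (auto simp: cylinder_def shift_funpow)
  show "x \<in> cylinder (u @ v)"
    unfolding cylinder_def
  proof (intro CollectI allI impI)
    fix j assume j: "j < length (u @ v)"
    show "x (int j) = (u @ v) ! j"
    proof (cases "j < length u")
      case False
      then show ?thesis using v[of "j - length u"] j by (simp add: nth_append of_nat_diff)
    qed (simp add: u nth_append)
  qed
qed

definition initial_word :: "nat \<Rightarrow> (int \<Rightarrow> nat) \<Rightarrow> nat list" where
  "initial_word n x = map (\<lambda>i. x (int i)) [0..<n]"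

lemma length_initial_word [simp]: "length (initial_word n x) = n"
  by (simp add: initial_word_def)

lemma in_cylinder_initial_word: "x \<in> cylinder (initial_word n x)"
  by (simp add: cylinder_def initial_word_def)

lemma initial_word_eqD:
  assumes "initial_word n x = initial_word n y" "i < n"
  shows "x (int i) = y (int i)"
  using arg_cong[OF assms(1), of "\<lambda>w. w ! i"] assms(2) by (simp add: initial_word_def)

section \<open>The metric and coordinates\<close>

lemma seq_dist_ge_1:
  assumes "x \<in> full_shift l" "y \<in> full_shift l" "x 0 \<noteq> y 0"
  shows "1 \<le> seq_dist x y"
proof -
  have "\<bar>real (x 0) - real (y 0)\<bar> \<le> seq_dist x y"
    using finite_sum_le_infsum[OF summable_seq_dist[OF assms(1,2)], of "{0}"]
    by (simp add: seq_dist_def)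
  moreover have "1 \<le> \<bar>real (x 0) - real (y 0)\<bar>"
    using assms(3) by linarith
  ultimately show ?thesis by linarith
qed

text \<open>The weights \<open>exp (- \<bar>j\<bar>)\<close> are summable, so far-away coordinates are
  negligible uniformly in the pair of sequences.\<close>

lemma seq_dist_le_if_agree_near_0:
  assumes "0 < \<epsilon>"
  obtains m :: nat where
    "\<And>x y. x \<in> full_shift l \<Longrightarrow> y \<in> full_shift l \<Longrightarrow>
       (\<And>j. \<bar>j\<bar> \<le> int m \<Longrightarrow> x j = y j) \<Longrightarrow> seq_dist x y \<le> \<epsilon>"
proof -
  define e where "e = (\<lambda>j::int. exp (- \<bar>real_of_int j\<bar>))"
  define T where "T = infsum e UNIV"
  have summ: "e summable_on A" for A
    unfolding e_def by (rule summable_on_subset_banach[OF summable_exp_neg_abs_int]) auto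
  define \<delta> where "\<delta> = \<epsilon> / (real l + 1)"
  have \<delta>: "0 < \<delta>" using assms by (simp add: \<delta>_def)
  have "(sum e \<longlongrightarrow> T) (finite_subsets_at_top UNIV)"
    using has_sum_infsum[OF summ[of UNIV]] by (simp add: has_sum_def T_def)
  then have "\<forall>\<^sub>F F in finite_subsets_at_top UNIV. T - \<delta> < sum e F"
    by (rule order_tendstoD(1)) (use \<delta> in simp)
  then obtain F where F: "finite F" "T - \<delta> < sum e F"
    by (auto simp: eventually_finite_subsets_at_top)
  define m where "m = nat (Max (insert 0 (abs ` F)))"
  have Fm: "F \<subseteq> {j. \<bar>j\<bar> \<le> int m}"
  proof
    fix j assume "j \<in> F"
    then have "\<bar>j\<bar> \<le> Max (insert 0 (abs ` F))" using F(1) by (intro Max_ge) auto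
    then show "j \<in> {j. \<bar>j\<bar> \<le> int m}" unfolding m_def by simp linarith
  qed
  have near_far: "sum e F + infsum e {j. \<bar>j\<bar> > int m} \<le> T"
  proof -
    have "sum e F + infsum e {j. \<bar>j\<bar> > int m} = infsum e (F \<union> {j. \<bar>j\<bar> > int m})"
      using Fm F(1) by (subst infsum_Un_disjoint[OF summ summ]) auto
    also have "\<dots> \<le> T"
      unfolding T_def by (intro infsum_mono_neutral summ) (auto simp: e_def)
    finally show ?thesis .
  qed
  show thesis
  proof (rule that[of m])
    fix x y assume xy: "x \<in> full_shift l" "y \<in> full_shift l"
      and agree: "\<And>j. \<bar>j\<bar> \<le> int m \<Longrightarrow> x j = y j"
    have le: "\<bar>real (x j) - real (y j)\<bar> \<le> real l" for j
    proof -
      have "x j \<le> l" "y j \<le> l" using xy by (auto simp: full_shift_def)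
      then show ?thesis by linarith
    qed
    have "seq_dist x y \<le> infsum (\<lambda>j. e j * real l) {j. \<bar>j\<bar> > int m}"
      unfolding seq_dist_def
    proof (rule infsum_mono_neutral)
      show "(\<lambda>j. exp (- \<bar>real_of_int j\<bar>) * \<bar>real (x j) - real (y j)\<bar>) summable_on UNIV"
        by (rule summable_seq_dist[OF xy])
      show "(\<lambda>j. e j * real l) summable_on {j. \<bar>j\<bar> > int m}"
        by (intro summable_on_cmult_left summ)
    qed (auto simp: e_def agree le intro!: mult_left_mono)
    also have "\<dots> = infsum e {j. \<bar>j\<bar> > int m} * real l"
      by (intro infsum_cmult_left summ)
    also have "\<dots> \<le> \<delta> * real l"
      using near_far F(2) by (intro mult_right_mono) auto
    also have "\<dots> \<le> \<epsilon>"
      using assms by (simp add: \<delta>_def field_simps)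
    finally show "seq_dist x y \<le> \<epsilon>" .
  qed
qed

section \<open>Word weights and partition sums\<close>

definition word_weight ::
    "(int \<Rightarrow> nat) set \<Rightarrow> ((int \<Rightarrow> nat) \<Rightarrow> real) \<Rightarrow> nat list \<Rightarrow> real" where
  "word_weight X f w = (SUP x \<in> cylinder w \<inter> X. exp (birkhoff_sum (length w) f x))"

definition words_of_length :: "(int \<Rightarrow> nat) set \<Rightarrow> nat \<Rightarrow> nat list set" where
  "words_of_length X n = {w \<in> allowed_words X. length w = n}"

definition partition_sum ::
    "(int \<Rightarrow> nat) set \<Rightarrow> ((int \<Rightarrow> nat) \<Rightarrow> real) \<Rightarrow> nat \<Rightarrow> real" where
  "partition_sum X f n = (\<Sum>w\<in>words_of_length X n. word_weight X f w)"

locale invariant_set =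
  fixes l :: nat and X :: "(int \<Rightarrow> nat) set"
  assumes X_subset: "X \<subseteq> full_shift l"
    and X_nonempty: "X \<noteq> {}"
    and shift_image: "shift ` X = X"
begin

lemma shift_funpow_image: "(shift ^^ k) ` X = X"
proof (induction k)
  case (Suc k)
  have "(shift ^^ Suc k) ` X = shift ` (shift ^^ k) ` X" by (simp add: image_comp)
  then show ?case by (simp only: Suc shift_image)
qed simp

lemma shift_funpow_in: "x \<in> X \<Longrightarrow> (shift ^^ k) x \<in> X"
  using shift_funpow_image[of k] by blast

lemma unshift_in:
  assumes "x \<in> X"
  shows "(\<lambda>j. x (j - int k)) \<in> X"
proof -
  obtain y where y: "y \<in> X" "(shift ^^ k) y = x"
    using assms shift_funpow_image[of k] by (metis imageE)
  then have "(\<lambda>j. x (j - int k)) = y"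
    by (auto simp: shift_funpow)
  then show ?thesis using y by simp
qed

text \<open>By invariance of \<open>X\<close> an occurrence of a word can be moved to position \<open>0\<close>;
  occurrences at negative positions are moved with surjectivity of the shift.\<close>

lemma allowed_words_iff: "w \<in> allowed_words X \<longleftrightarrow> cylinder w \<inter> X \<noteq> {}"
proof
  assume "w \<in> allowed_words X"
  then obtain x m where x: "x \<in> X" and m: "\<And>j. j < length w \<Longrightarrow> x (m + int j) = w ! j"
    by (auto simp: allowed_words_def)
  have "(\<lambda>j. x (m + j)) \<in> X"
  proof (cases "0 \<le> m")
    case True
    then show ?thesis using shift_funpow_in[OF x, of "nat m"] by (simp add: shift_funpow add.commute)
  next
    case False
    then show ?thesis using unshift_in[OF x, of "nat (- m)"] by (simp add: add.commute)
  qed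
  moreover have "(\<lambda>j. x (m + j)) \<in> cylinder w" using m by (simp add: cylinder_def)
  ultimately show "cylinder w \<inter> X \<noteq> {}" by blast
next
  assume "cylinder w \<inter> X \<noteq> {}"
  then obtain x where x: "x \<in> X" "x \<in> cylinder w" by blast
  then have "\<forall>j<length w. x (0 + int j) = w ! j" by (simp add: cylinder_def)
  with x(1) show "w \<in> allowed_words X" unfolding allowed_words_def by blast
qed

lemma allowed_appendD:
  assumes "u @ v \<in> allowed_words X"
  shows "u \<in> allowed_words X" "v \<in> allowed_words X"
proof -
  obtain x where "x \<in> X" "x \<in> cylinder (u @ v)" using assms by (auto simp: allowed_words_iff)
  then show "u \<in> allowed_words X" "v \<in> allowed_words X"
    using shift_funpow_in[of x "length u"] by (auto simp: allowed_words_iff cylinder_append)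
qed

lemma allowed_take: "w \<in> allowed_words X \<Longrightarrow> take n w \<in> allowed_words X"
  using allowed_appendD(1)[of "take n w" "drop n w"] by simp

lemma initial_word_in: "x \<in> X \<Longrightarrow> initial_word n x \<in> words_of_length X n"
  using in_cylinder_initial_word[of x n] by (auto simp: words_of_length_def allowed_words_iff)

lemma words_of_length_nonempty: "words_of_length X n \<noteq> {}"
  using X_nonempty initial_word_in by fastforce

lemma allowed_letters:
  assumes "w \<in> allowed_words X"
  shows "set w \<subseteq> {1..l}"
proof
  fix a assume "a \<in> set w"
  then obtain j where "j < length w" "a = w ! j" by (auto simp: in_set_conv_nth)
  moreover obtain x where "x \<in> X" "x \<in> cylinder w" using assms by (auto simp: allowed_words_iff)
  ultimately have "a = x (int j)" by (simp add: cylinder_def)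
  then show "a \<in> {1..l}" using X_subset \<open>x \<in> X\<close> by (auto simp: full_shift_def)
qed

lemma finite_bounded_words: "finite {w \<in> allowed_words X. length w \<le> n}"
  by (rule finite_subset[OF _ finite_lists_length_le[of "{1..l}" n]])
    (use allowed_letters in auto)

lemma finite_words_of_length: "finite (words_of_length X n)"
  by (rule finite_subset[OF _ finite_bounded_words[of n]]) (auto simp: words_of_length_def)

end

locale bounded_potential = invariant_set +
  fixes f :: "(int \<Rightarrow> nat) \<Rightarrow> real" and M :: real
  assumes potential_bound: "x \<in> X \<Longrightarrow> \<bar>f x\<bar> \<le> M"
begin

lemma birkhoff_sum_bound:
  assumes "x \<in> X"
  shows "\<bar>birkhoff_sum n f x\<bar> \<le> real n * M"
proof -
  have "\<bar>birkhoff_sum n f x\<bar> \<le> (\<Sum>k<n. \<bar>f ((shift ^^ k) x)\<bar>)"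
    unfolding birkhoff_sum_def by (rule sum_abs)
  also have "\<dots> \<le> (\<Sum>k<n. M)"
    by (intro sum_mono potential_bound shift_funpow_in assms)
  finally show ?thesis by simp
qed

lemma bdd_above_weights:
  "bdd_above ((\<lambda>x. exp (birkhoff_sum (length w) f x)) ` (cylinder w \<inter> X))"
proof (rule bdd_aboveI2)
  fix x assume "x \<in> cylinder w \<inter> X"
  then show "exp (birkhoff_sum (length w) f x) \<le> exp (real (length w) * M)"
    using birkhoff_sum_bound[of x "length w"] by simp
qed

lemma exp_birkhoff_le_word_weight:
  "x \<in> cylinder w \<Longrightarrow> x \<in> X \<Longrightarrow> exp (birkhoff_sum (length w) f x) \<le> word_weight X f w"
  unfolding word_weight_def by (rule cSUP_upper[OF _ bdd_above_weights]) simp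

lemma word_weight_le:
  assumes "w \<in> allowed_words X"
    "\<And>x. x \<in> cylinder w \<Longrightarrow> x \<in> X \<Longrightarrow> exp (birkhoff_sum (length w) f x) \<le> B"
  shows "word_weight X f w \<le> B"
  unfolding word_weight_def
  by (rule cSUP_least) (use assms in \<open>auto simp: allowed_words_iff\<close>)

lemma word_weight_pos:
  assumes "w \<in> allowed_words X"
  shows "0 < word_weight X f w"
proof -
  obtain x where "x \<in> cylinder w" "x \<in> X" using assms by (auto simp: allowed_words_iff)
  then show ?thesis
    using exp_birkhoff_le_word_weight exp_gt_zero less_le_trans by blast
qed

text \<open>The Birkhoff sum splits at the end of the first word, and the shifted point
  lies in the cylinder of the second one.\<close>

lemma word_weight_append:
  assumes "u @ v \<in> allowed_words X"
  shows "word_weight X f (u @ v) \<le> word_weight X f u * word_weight X f v"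
proof (rule word_weight_le[OF assms])
  fix x assume "x \<in> cylinder (u @ v)" "x \<in> X"
  then show "exp (birkhoff_sum (length (u @ v)) f x) \<le> word_weight X f u * word_weight X f v"
    unfolding length_append birkhoff_sum_add exp_add
    using word_weight_pos[OF allowed_appendD(1)[OF assms]]
    by (intro mult_mono exp_birkhoff_le_word_weight)
      (auto simp: cylinder_append intro: shift_funpow_in)
qed

lemma partition_sum_pos: "0 < partition_sum X f n"
  unfolding partition_sum_def
  by (intro sum_pos finite_words_of_length words_of_length_nonempty word_weight_pos)
    (simp add: words_of_length_def)

text \<open>Cutting every word of length \<open>n\<close> at a position that may depend on the word is injective,
  so only the set of possible pieces matters.\<close>

lemma partition_sum_le_cut:
  assumes "finite B" "B \<subseteq> allowed_words X \<times> allowed_words X"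
    and cut: "\<And>w. w \<in> words_of_length X n \<Longrightarrow> \<exists>k. (take k w, drop k w) \<in> B"
  shows "partition_sum X f n \<le> (\<Sum>(u, v)\<in>B. word_weight X f u * word_weight X f v)"
proof -
  let ?W = "word_weight X f"
  obtain k where k: "\<And>w. w \<in> words_of_length X n \<Longrightarrow> (take (k w) w, drop (k w) w) \<in> B"
    using cut by metis
  let ?c = "\<lambda>w. (take (k w) w, drop (k w) w)"
  have inj: "inj_on ?c (words_of_length X n)"
    by (rule inj_onI) (metis append_take_drop_id prod.inject)
  have "partition_sum X f n \<le> (\<Sum>w\<in>words_of_length X n. ?W (take (k w) w) * ?W (drop (k w) w))"
    unfolding partition_sum_def
    using word_weight_append[of "take (k w) w" "drop (k w) w" for w]
    by (intro sum_mono) (simp add: words_of_length_def)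
  also have "\<dots> = (\<Sum>(u, v)\<in>?c ` words_of_length X n. ?W u * ?W v)"
    by (simp add: sum.reindex[OF inj])
  also have "\<dots> \<le> (\<Sum>(u, v)\<in>B. ?W u * ?W v)"
    using assms(1,2) k by (intro sum_mono2) (auto intro!: mult_nonneg_nonneg
      less_imp_le[OF word_weight_pos])
  finally show ?thesis .
qed

lemma partition_sum_submult:
  "partition_sum X f (m + n) \<le> partition_sum X f m * partition_sum X f n"
proof -
  have "partition_sum X f (m + n)
    \<le> (\<Sum>(u, v)\<in>words_of_length X m \<times> words_of_length X n. word_weight X f u * word_weight X f v)"
  proof (rule partition_sum_le_cut)
    show "\<exists>k. (take k w, drop k w) \<in> words_of_length X m \<times> words_of_length X n"
      if "w \<in> words_of_length X (m + n)" for w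
      using that allowed_appendD[of "take m w" "drop m w"]
      by (intro exI[of _ m]) (simp add: words_of_length_def)
  qed (auto simp: finite_words_of_length, auto simp: words_of_length_def)
  then show ?thesis
    by (simp add: partition_sum_def sum_product sum.cartesian_product)
qed

section \<open>Pressure as the growth rate of partition sums\<close>

text \<open>Up to a factor that depends on \<open>\<epsilon>\<close> only, a sum over a separated set is at most the sum
  over words. The choice of \<open>m\<close> makes coordinates beyond \<open>m\<close> contribute at most \<open>\<epsilon>\<close>.
  Hence points of the set are distinguished by their coordinates in \<open>{-m..<n+m}\<close> and inject into
  the words of length \<open>n + 2 * m\<close>; submultiplicativity removes the \<open>2 * m\<close> additional letters.\<close>

lemma separated_sum_upper:
  assumes "0 < \<epsilon>"
  obtains C where "0 < C"
    "\<And>n E. E \<subseteq> X \<Longrightarrow> finite E \<Longrightarrow> separated n \<epsilon> E \<Longrightarrow>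
       (\<Sum>x\<in>E. exp (birkhoff_sum n f x)) \<le> C * partition_sum X f n"
proof -
  obtain m :: nat where m:
    "\<And>x y. x \<in> full_shift l \<Longrightarrow> y \<in> full_shift l \<Longrightarrow>
       (\<And>j. \<bar>j\<bar> \<le> int m \<Longrightarrow> x j = y j) \<Longrightarrow> seq_dist x y \<le> \<epsilon>"
    using seq_dist_le_if_agree_near_0[OF assms, of l] by blast
  define D where "D = exp (2 * real m * M)"
  show thesis
  proof (rule that[of "D * partition_sum X f (2 * m)"])
    show "0 < D * partition_sum X f (2 * m)" by (simp add: D_def partition_sum_pos)
    fix n E assume E: "E \<subseteq> X" "finite E" "separated n \<epsilon> E"
    define p where "p = (\<lambda>x (j::int). x (j - int m) :: nat)"
    define u where "u = (\<lambda>x. initial_word (n + 2 * m) (p x))"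
    have p_in: "p x \<in> X" if "x \<in> X" for x
      using unshift_in[OF that, of m] by (simp add: p_def)
    have u_inj: "inj_on u E"
    proof (rule inj_onI, rule ccontr)
      fix x y assume xy: "x \<in> E" "y \<in> E" "u x = u y" "x \<noteq> y"
      then obtain k where k: "k < n" "seq_dist ((shift ^^ k) x) ((shift ^^ k) y) > \<epsilon>"
        using E(3) by (auto simp: separated_def)
      have "seq_dist ((shift ^^ k) x) ((shift ^^ k) y) \<le> \<epsilon>"
      proof (rule m)
        show "(shift ^^ k) x \<in> full_shift l" "(shift ^^ k) y \<in> full_shift l"
          using xy E(1) shift_funpow_in X_subset by blast+
        fix j :: int assume j: "\<bar>j\<bar> \<le> int m"
        then have "0 \<le> j + int k + int m" by linarith
        moreover from this have "nat (j + int k + int m) < n + 2 * m"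
          using j k(1) by (simp add: nat_less_iff)
        ultimately show "(shift ^^ k) x j = (shift ^^ k) y j"
          using initial_word_eqD[OF xy(3)[unfolded u_def], of "nat (j + int k + int m)"]
          by (simp add: shift_funpow p_def)
      qed
      with k(2) show False by simp
    qed
    have "exp (birkhoff_sum n f x) \<le> D * word_weight X f (u x)" if "x \<in> X" for x
    proof -
      have "(shift ^^ m) (p x) = x" by (simp add: shift_funpow p_def)
      then have "birkhoff_sum (m + (n + m)) f (p x)
        = birkhoff_sum m f (p x) + (birkhoff_sum n f x + birkhoff_sum m f ((shift ^^ n) x))"
        by (simp only: birkhoff_sum_add)
      moreover have "m + (n + m) = n + 2 * m" by simp
      ultimately have "birkhoff_sum n f x \<le> 2 * real m * M + birkhoff_sum (n + 2 * m) f (p x)"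
        using birkhoff_sum_bound[OF p_in[OF that], of m]
          birkhoff_sum_bound[OF shift_funpow_in[OF that], of m n]
        by (simp only: abs_le_iff) linarith
      then have "exp (birkhoff_sum n f x) \<le> D * exp (birkhoff_sum (n + 2 * m) f (p x))"
        by (simp add: D_def flip: exp_add)
      also have "\<dots> \<le> D * word_weight X f (u x)"
        using exp_birkhoff_le_word_weight[OF in_cylinder_initial_word p_in[OF that], of "n + 2 * m"]
        by (simp add: D_def u_def)
      finally show ?thesis .
    qed
    then have "(\<Sum>x\<in>E. exp (birkhoff_sum n f x)) \<le> (\<Sum>x\<in>E. D * word_weight X f (u x))"
      using E(1) by (intro sum_mono) auto
    also have "\<dots> = D * (\<Sum>w\<in>u ` E. word_weight X f w)"
      by (simp add: sum.reindex[OF u_inj] sum_distrib_left)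
    also have "\<dots> \<le> D * partition_sum X f (n + 2 * m)"
      unfolding partition_sum_def
    proof (intro mult_left_mono sum_mono2 finite_words_of_length)
      show "u ` E \<subseteq> words_of_length X (n + 2 * m)"
        using E(1) p_in initial_word_in by (auto simp: u_def)
    qed (auto simp: D_def words_of_length_def intro!: less_imp_le[OF word_weight_pos])
    also have "\<dots> \<le> D * (partition_sum X f n * partition_sum X f (2 * m))"
      by (intro mult_left_mono partition_sum_submult) (simp add: D_def)
    finally show "(\<Sum>x\<in>E. exp (birkhoff_sum n f x))
        \<le> D * partition_sum X f (2 * m) * partition_sum X f n"
      by (simp add: mult_ac)
  qed
qed

text \<open>One nearly optimal point per word gives a separated set: different words of length
  \<open>n\<close> differ at some position \<open>k < n\<close>, which puts the \<open>k\<close>-th iterates at distance at least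
  \<open>1\<close>. The factor \<open>2\<close> replaces the attainment of the supremum.\<close>

lemma separated_sum_lower:
  assumes "\<epsilon> < 1"
  obtains E where "E \<subseteq> X" "finite E" "separated n \<epsilon> E"
    "partition_sum X f n \<le> 2 * (\<Sum>x\<in>E. exp (birkhoff_sum n f x))"
proof -
  have "\<exists>x. x \<in> cylinder w \<and> x \<in> X \<and> word_weight X f w \<le> 2 * exp (birkhoff_sum (length w) f x)"
    if "w \<in> words_of_length X n" for w
  proof -
    have w: "w \<in> allowed_words X" using that by (simp add: words_of_length_def)
    have "word_weight X f w / 2 < word_weight X f w"
      using word_weight_pos[OF w] by simp
    then obtain x where "x \<in> cylinder w \<inter> X"
      "word_weight X f w / 2 < exp (birkhoff_sum (length w) f x)"
      unfolding word_weight_def[of X f w]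
      using less_cSUP_iff[OF _ bdd_above_weights] w allowed_words_iff by metis
    then show ?thesis by (intro exI[of _ x]) auto
  qed
  then obtain p where p: "\<And>w. w \<in> words_of_length X n \<Longrightarrow> p w \<in> cylinder w"
    "\<And>w. w \<in> words_of_length X n \<Longrightarrow> p w \<in> X"
    "\<And>w. w \<in> words_of_length X n \<Longrightarrow> word_weight X f w \<le> 2 * exp (birkhoff_sum (length w) f (p w))"
    by metis
  have inj: "inj_on p (words_of_length X n)"
  proof (rule inj_onI)
    fix v w assume vw: "v \<in> words_of_length X n" "w \<in> words_of_length X n" "p v = p w"
    then show "v = w"
      using p(1)[OF vw(1)] p(1)[OF vw(2)]
      by (intro nth_equalityI) (auto simp: cylinder_def words_of_length_def)
  qed
  show thesis
  proof (rule that[of "p ` words_of_length X n"])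
    show "p ` words_of_length X n \<subseteq> X" using p(2) by auto
    show "finite (p ` words_of_length X n)" by (simp add: finite_words_of_length)
    show "separated n \<epsilon> (p ` words_of_length X n)"
      unfolding separated_def
    proof clarify
      fix v w assume vw: "v \<in> words_of_length X n" "w \<in> words_of_length X n" "p v \<noteq> p w"
      have len: "length v = n" "length w = n" using vw by (auto simp: words_of_length_def)
      have "v \<noteq> w" using vw by auto
      then obtain k where k: "k < n" "v ! k \<noteq> w ! k" using len by (metis nth_equalityI)
      have "(shift ^^ k) (p v) 0 \<noteq> (shift ^^ k) (p w) 0"
        using p(1)[OF vw(1)] p(1)[OF vw(2)] k len by (simp add: shift_funpow cylinder_def)
      then have "1 \<le> seq_dist ((shift ^^ k) (p v)) ((shift ^^ k) (p w))"
        using vw(1,2) p(2) shift_funpow_in X_subset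
        by (intro seq_dist_ge_1[of _ l]) blast+
      with k(1) assms show "\<exists>k<n. \<epsilon> < seq_dist ((shift ^^ k) (p v)) ((shift ^^ k) (p w))"
        by (intro exI[of _ k]) simp
    qed
    have "partition_sum X f n \<le> (\<Sum>w\<in>words_of_length X n. 2 * exp (birkhoff_sum n f (p w)))"
      unfolding partition_sum_def using p(3)
      by (intro sum_mono) (auto simp: words_of_length_def)
    then show "partition_sum X f n
        \<le> 2 * (\<Sum>x\<in>p ` words_of_length X n. exp (birkhoff_sum n f x))"
      by (simp add: sum.reindex[OF inj] sum_distrib_left)
  qed
qed

end

lemma limsup_ln_rate_mono:
  fixes a b :: "nat \<Rightarrow> real"
  assumes "0 < C" "\<And>n. 0 < b n" "\<And>n. b n \<le> C * a n"
  shows "limsup (\<lambda>n. ereal (1 / real n * ln (b n))) \<le> limsup (\<lambda>n. ereal (1 / real n * ln (a n)))"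
proof -
  have "1 / real n * ln (b n) \<le> ln C / real n + 1 / real n * ln (a n)" for n
  proof -
    have "0 < C * a n" using assms(2,3)[of n] by linarith
    then have a: "0 < a n" using assms(1) by (simp add: zero_less_mult_iff)
    have "ln (b n) \<le> ln (C * a n)" using assms a by (intro ln_mono) auto
    then have "ln (b n) \<le> ln C + ln (a n)" using assms(1) a by (simp add: ln_mult)
    from divide_right_mono[OF this, of "real n"] show ?thesis by (simp add: add_divide_distrib)
  qed
  then have "limsup (\<lambda>n. ereal (1 / real n * ln (b n)))
    \<le> limsup (\<lambda>n. ereal (ln C / real n) + ereal (1 / real n * ln (a n)))"
    by (intro Limsup_mono always_eventually allI) simp
  also have "\<dots> = 0 + limsup (\<lambda>n. ereal (1 / real n * ln (a n)))"
  proof (rule ereal_limsup_lim_add)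
    show "(\<lambda>n. ereal (ln C / real n)) \<longlonglongrightarrow> 0"
      unfolding zero_ereal_def lim_ereal by (rule lim_const_over_n)
  qed simp
  finally show ?thesis by simp
qed

context bounded_potential
begin

text \<open>Different letters are at distance at least \<open>1\<close>, so for every \<open>\<epsilon> < 1\<close> the separated sums
  agree with the partition sums up to constant factors, which the exponential growth rate does
  not see. So the expression under the limit is constant near \<open>0\<close>.\<close>

lemma pressure_eq_partition_growth:
  "pressure X f = limsup (\<lambda>n. ereal (1 / real n * ln (partition_sum X f n)))"
proof -
  let ?Q = "\<lambda>\<epsilon> n. SUP E \<in> {E. E \<subseteq> X \<and> finite E \<and> separated n \<epsilon> E}.
    \<Sum>x\<in>E. exp (birkhoff_sum n f x)"
  let ?L = "\<lambda>a. limsup (\<lambda>n. ereal (1 / real n * ln (a n :: real)))"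
  have eq: "?L (?Q \<epsilon>) = ?L (partition_sum X f)" if \<epsilon>: "0 < \<epsilon>" "\<epsilon> < 1" for \<epsilon>
  proof -
    obtain C where C: "0 < C"
      "\<And>n E. E \<subseteq> X \<Longrightarrow> finite E \<Longrightarrow> separated n \<epsilon> E \<Longrightarrow>
         (\<Sum>x\<in>E. exp (birkhoff_sum n f x)) \<le> C * partition_sum X f n"
      using separated_sum_upper[OF \<epsilon>(1)] by blast
    have upper: "?Q \<epsilon> n \<le> C * partition_sum X f n" for n
    proof (rule cSUP_least)
      have "{} \<in> {E. E \<subseteq> X \<and> finite E \<and> separated n \<epsilon> E}" by (simp add: separated_def)
      then show "{E. E \<subseteq> X \<and> finite E \<and> separated n \<epsilon> E} \<noteq> {}" by blast
    qed (use C(2) in auto)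
    have lower: "partition_sum X f n \<le> 2 * ?Q \<epsilon> n" for n
    proof -
      obtain E where E: "E \<subseteq> X" "finite E" "separated n \<epsilon> E"
        "partition_sum X f n \<le> 2 * (\<Sum>x\<in>E. exp (birkhoff_sum n f x))"
        using separated_sum_lower[OF \<epsilon>(2)] by blast
      have "(\<Sum>x\<in>E. exp (birkhoff_sum n f x)) \<le> ?Q \<epsilon> n"
      proof (rule cSUP_upper)
        show "E \<in> {E. E \<subseteq> X \<and> finite E \<and> separated n \<epsilon> E}" using E by simp
        show "bdd_above ((\<lambda>E. \<Sum>x\<in>E. exp (birkhoff_sum n f x)) `
            {E. E \<subseteq> X \<and> finite E \<and> separated n \<epsilon> E})"
          using C(2) by (intro bdd_aboveI2[where M = "C * partition_sum X f n"]) auto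
      qed
      with E(4) show ?thesis by linarith
    qed
    have Q_pos: "0 < ?Q \<epsilon> n" for n
      using lower[of n] partition_sum_pos[of n] by linarith
    show ?thesis
      using limsup_ln_rate_mono[of C "?Q \<epsilon>", OF C(1) Q_pos upper]
        limsup_ln_rate_mono[of 2 "partition_sum X f", OF _ partition_sum_pos lower]
      by (simp add: order_antisym)
  qed
  have "\<forall>\<^sub>F \<epsilon> in at_right 0. ?L (?Q \<epsilon>) = ?L (partition_sum X f)"
  proof (rule eventually_at_rightI)
    show "?L (?Q \<epsilon>) = ?L (partition_sum X f)" if "\<epsilon> \<in> {0<..<1}" for \<epsilon>
      by (rule eq) (use that in auto)
  qed simp
  then have "((\<lambda>\<epsilon>. ?L (?Q \<epsilon>)) \<longlongrightarrow> ?L (partition_sum X f)) (at_right 0)"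
    by (rule tendsto_eventually)
  then show ?thesis
    unfolding pressure_def by (intro tendsto_Lim) simp_all
qed

lemma partition_sum_subexponential:
  assumes "pressure X f = 0" "0 < \<delta>"
  obtains K where "\<And>n. partition_sum X f n \<le> K * exp (\<delta> * real n)"
proof -
  have "limsup (\<lambda>n. ereal (1 / real n * ln (partition_sum X f n))) < ereal \<delta>"
    using assms by (simp add: pressure_eq_partition_growth)
  then have "\<forall>\<^sub>F n in sequentially. ereal (1 / real n * ln (partition_sum X f n)) < ereal \<delta>"
    by (rule Limsup_lessD)
  then obtain n0 where n0: "\<And>n. n \<ge> n0 \<Longrightarrow> 1 / real n * ln (partition_sum X f n) < \<delta>"
    by (auto simp: eventually_sequentially)
  define K where "K = 1 + (\<Sum>n\<le>n0. partition_sum X f n)"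
  have K: "1 \<le> K" "\<And>n. n \<le> n0 \<Longrightarrow> partition_sum X f n \<le> K"
  proof -
    show "1 \<le> K" by (simp add: K_def sum_nonneg less_imp_le[OF partition_sum_pos])
    fix n assume "n \<le> n0"
    then have "partition_sum X f n \<le> (\<Sum>n\<le>n0. partition_sum X f n)"
      by (intro member_le_sum less_imp_le[OF partition_sum_pos]) auto
    then show "partition_sum X f n \<le> K" by (simp add: K_def)
  qed
  show thesis
  proof (rule that[of K])
    fix n
    have one: "1 \<le> exp (\<delta> * real n)" using assms(2) by simp
    show "partition_sum X f n \<le> K * exp (\<delta> * real n)"
    proof (cases "n \<le> n0")
      case True
      then show ?thesis using K(2)[OF True] mult_left_mono[OF one, of K] K(1) by linarith
    next
      case False
      then have "ln (partition_sum X f n) < \<delta> * real n"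
        using n0[of n] by (simp add: field_simps)
      then have "partition_sum X f n < exp (\<delta> * real n)"
        using partition_sum_pos[of n] by (metis exp_less_cancel_iff exp_ln)
      moreover have "exp (\<delta> * real n) \<le> K * exp (\<delta> * real n)" using K(1) by simp
      ultimately show ?thesis by linarith
    qed
  qed
qed

lemma pressure_neg_of_exponential_decay:
  assumes "0 < \<rho>" "\<rho> < 1" "\<And>n. partition_sum X f n \<le> K * \<rho> ^ n"
  shows "pressure X f < 0"
proof -
  have "0 < K" using partition_sum_pos[of 0] assms(3)[of 0] by simp
  then have "limsup (\<lambda>n. ereal (1 / real n * ln (partition_sum X f n)))
    \<le> limsup (\<lambda>n. ereal (1 / real n * ln (\<rho> ^ n)))"
    by (rule limsup_ln_rate_mono[OF _ partition_sum_pos assms(3)])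
  also have "\<dots> = limsup (\<lambda>n. ereal (ln \<rho>))"
    using assms(1)
    by (intro Limsup_eq eventually_sequentiallyI[of 1]) (simp add: ln_realpow)
  also have "\<dots> = ereal (ln \<rho>)" by (simp add: Limsup_const)
  also have "\<dots> < 0" using assms by simp
  finally show ?thesis by (simp add: pressure_eq_partition_growth)
qed

section \<open>Complete prefix sets\<close>

text \<open>The key step, a renewal argument. Cutting off a first word \<open>u \<in> A\<close> gives
  \<open>Z n \<le> (\<Sum>u\<in>A. W u * Z (n - length u))\<close> for the partition sums \<open>Z\<close> and the weights \<open>W\<close>.
  If the total weight of \<open>A\<close> were some \<open>G < 1\<close>, then with \<open>\<rho> ^ N = G\<close> induction would give
  \<open>Z n \<le> K * \<rho> ^ n\<close>: a first word has at most \<open>N\<close> letters, so removing it enlarges the bound by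
  at most \<open>1 / \<rho> ^ N\<close>, and the factor \<open>G\<close> compensates this.\<close>

lemma complete_prefix_set_weight_ge_1:
  assumes "pressure X f = 0"
    and A_words: "A \<subseteq> allowed_words X"
    and A_length: "\<And>u. u \<in> A \<Longrightarrow> u \<noteq> [] \<and> length u \<le> N"
    and A_complete: "\<And>w. w \<in> allowed_words X \<Longrightarrow> N \<le> length w \<Longrightarrow> \<exists>k. take k w \<in> A"
  shows "1 \<le> (\<Sum>u\<in>A. word_weight X f u)"
proof (rule ccontr)
  let ?W = "word_weight X f" and ?Z = "partition_sum X f"
  define G where "G = (\<Sum>u\<in>A. ?W u)"
  assume "\<not> 1 \<le> (\<Sum>u\<in>A. ?W u)"
  then have "G < 1" by (simp add: G_def)
  have fin: "finite A"
    by (rule finite_subset[OF _ finite_bounded_words[of N]]) (use A_words A_length in auto)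
  have W_pos: "0 < ?W u" if "u \<in> A" for u
    using that A_words word_weight_pos by blast
  obtain w0 where "w0 \<in> words_of_length X N" using words_of_length_nonempty by blast
  then obtain u0 where "u0 \<in> A" using A_complete[of w0] by (auto simp: words_of_length_def)
  then have "0 < G" using fin W_pos by (auto simp: G_def intro!: sum_pos)
  have "0 < N" using A_length[OF \<open>u0 \<in> A\<close>] by (cases u0) auto
  define \<rho> where "\<rho> = root N G"
  have \<rho>: "0 < \<rho>" "\<rho> < 1" "\<rho> ^ N = G"
    using \<open>0 < G\<close> \<open>G < 1\<close> \<open>0 < N\<close> by (simp_all add: \<rho>_def)
  have renewal: "?Z n \<le> (\<Sum>u\<in>A. ?W u * ?Z (n - length u))" if "N \<le> n" for n
  proof -
    have "?Z n \<le> (\<Sum>(u, v)\<in>Sigma A (\<lambda>u. words_of_length X (n - length u)). ?W u * ?W v)"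
    proof (rule partition_sum_le_cut)
      fix w assume w: "w \<in> words_of_length X n"
      then obtain k where "take k w \<in> A"
        using A_complete[of w] \<open>N \<le> n\<close> by (auto simp: words_of_length_def)
      moreover have "drop k w \<in> words_of_length X (n - length (take k w))"
        using w allowed_appendD(2)[of "take k w" "drop k w"] by (auto simp: words_of_length_def)
      ultimately show "\<exists>k. (take k w, drop k w) \<in> Sigma A (\<lambda>u. words_of_length X (n - length u))"
        by blast
    qed (use A_words fin finite_words_of_length in \<open>auto simp: words_of_length_def\<close>)
    also have "\<dots> = (\<Sum>u\<in>A. ?W u * ?Z (n - length u))"
      by (simp add: sum.Sigma[symmetric] fin finite_words_of_length partition_sum_def
          sum_distrib_left)
    finally show ?thesis .
  qed
  define K where "K = (\<Sum>n\<le>N. ?Z n / \<rho> ^ n)"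
  have decay: "?Z n \<le> K * \<rho> ^ n" for n
  proof (induction n rule: less_induct)
    case (less n)
    show ?case
    proof (cases "N \<le> n")
      case False
      have "?Z n / \<rho> ^ n \<le> K"
        unfolding K_def using False \<rho>(1)
        by (intro member_le_sum[of n _ "\<lambda>n. ?Z n / \<rho> ^ n"])
          (auto intro!: divide_nonneg_nonneg less_imp_le[OF partition_sum_pos])
      then show ?thesis using \<rho>(1) by (simp add: field_simps)
    next
      case True
      have K: "0 \<le> K"
        unfolding K_def using \<rho>(1)
        by (intro sum_nonneg divide_nonneg_pos less_imp_le[OF partition_sum_pos]) auto
      have "?Z n \<le> (\<Sum>u\<in>A. ?W u * ?Z (n - length u))" by (rule renewal[OF True])
      also have "\<dots> \<le> (\<Sum>u\<in>A. ?W u * (K * \<rho> ^ (n - N)))"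
      proof (intro sum_mono mult_left_mono)
        fix u assume u: "u \<in> A"
        have "?Z (n - length u) \<le> K * \<rho> ^ (n - length u)"
          using A_length[OF u] \<open>0 < N\<close> True by (intro less.IH) (cases u; auto)
        also have "\<dots> \<le> K * \<rho> ^ (n - N)"
          using A_length[OF u] True \<rho> K
          by (intro mult_left_mono power_decreasing) auto
        finally show "?Z (n - length u) \<le> K * \<rho> ^ (n - N)" .
      qed (simp add: less_imp_le[OF W_pos])
      also have "\<dots> = K * (\<rho> ^ N * \<rho> ^ (n - N))"
        by (simp add: sum_distrib_right[symmetric] G_def[symmetric] \<rho>(3))
      also have "\<dots> = K * \<rho> ^ n"
        using True by (simp flip: power_add)
      finally show ?thesis .
    qed
  qed
  show False
    using pressure_neg_of_exponential_decay[OF \<rho>(1,2) decay] assms(1) by simp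
qed

end

section \<open>Words cut at a given level\<close>

locale negative_potential = bounded_potential l X h M
  for l X h M +
  fixes c :: real
  assumes c_pos: "0 < c"
    and potential_le: "x \<in> X \<Longrightarrow> h x \<le> - c"
begin

lemma word_weight_decay:
  assumes "w \<in> allowed_words X"
  shows "word_weight X h w \<le> exp (- c * real (length w))"
proof (rule word_weight_le[OF assms])
  fix x assume x: "x \<in> X"
  have "birkhoff_sum (length w) h x \<le> (\<Sum>k<length w. - c)"
    unfolding birkhoff_sum_def by (intro sum_mono potential_le shift_funpow_in x)
  then show "exp (birkhoff_sum (length w) h x) \<le> exp (- c * real (length w))"
    by (simp add: mult.commute)
qed

lemma cut_words_alt:
  "w \<in> cut_words X h r \<longleftrightarrow> w \<in> allowed_words X \<and> w \<noteq> [] \<and>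
     word_weight X h w < r \<and> r \<le> word_weight X h (butlast w)"
  by (simp add: cut_words_def word_weight_def)

lemma cut_words_length:
  assumes "w \<in> cut_words X h r" "0 < r"
  shows "real (length w) \<le> - ln r / c + 1"
proof -
  have w: "w \<in> allowed_words X" "w \<noteq> []" "r \<le> word_weight X h (butlast w)"
    using assms by (auto simp: cut_words_alt)
  have "r \<le> exp (- c * real (length (butlast w)))"
    using w word_weight_decay[of "butlast w"] allowed_take[of w "length w - 1"]
    by (simp add: butlast_conv_take)
  then have "ln r \<le> - c * real (length (butlast w))"
    using assms(2) by (metis ln_exp ln_mono)
  also have "real (length (butlast w)) = real (length w) - 1"
    using w(2) by (cases w) auto
  finally show ?thesis using c_pos by (simp add: field_simps)
qed

text \<open>Since \<open>r\<close> does not exceed the weight \<open>1\<close> of the empty word, the first prefix of weight below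
  \<open>r\<close> is nonempty, and removing its last letter brings the weight back to at least \<open>r\<close>.\<close>

lemma cut_words_complete:
  assumes "r \<le> 1" "w \<in> allowed_words X" "exp (- c * real (length w)) < r"
  shows "\<exists>k. take k w \<in> cut_words X h r"
proof -
  let ?P = "\<lambda>k. word_weight X h (take k w) < r"
  define k where "k = (LEAST k. ?P k)"
  have P: "?P (length w)" using word_weight_decay[OF assms(2)] assms(3) by simp
  have k: "?P k" "k \<le> length w"
    unfolding k_def using P by (rule LeastI, rule Least_le)
  obtain x where "x \<in> X" using X_nonempty by blast
  then have "1 \<le> word_weight X h []"
    using exp_birkhoff_le_word_weight[of x "[]"] by (simp add: cylinder_def birkhoff_sum_def)
  then have "k \<noteq> 0" using k(1) assms(1) by (cases k) auto
  then have "\<not> ?P (k - 1)" using not_less_Least[of "k - 1" ?P] by (simp flip: k_def)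
  moreover have "butlast (take k w) = take (k - 1) w" using k(2) by (simp add: butlast_take)
  ultimately have "take k w \<in> cut_words X h r"
    using k \<open>k \<noteq> 0\<close> allowed_take[OF assms(2)] by (auto simp: cut_words_alt)
  then show ?thesis ..
qed

end

lemma compact_image_if_compactin:
  assumes "compactin T S" "continuous_map (subtopology T S) euclideanreal f"
  shows "compact (f ` S)"
  using image_compactin[of "subtopology T S" S euclideanreal f] assms
  by (simp add: compactin_subtopology)

theorem proposition3p9:
  fixes l :: nat and X :: "(int \<Rightarrow> nat) set" and g h :: "(int \<Rightarrow> nat) \<Rightarrow> real" and t :: real
  assumes "two_sided_subshift l X"
    and "continuous_map (subtopology (seq_topology l) X) euclideanreal g"
    and "continuous_map (subtopology (seq_topology l) X) euclideanreal h"
    and "\<forall>x\<in>X. h x < 0"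
    and "pressure X (\<lambda>x. g x + t * h x) = 0"
  shows "((\<lambda>r. ln (Gamma_sum X g h t r) / ln r) \<longlongrightarrow> 0) (at_right 0)"
proof -
  define f where "f = (\<lambda>x. g x + t * h x)"
  let ?\<Gamma> = "Gamma_sum X g h t"
  have X: "X \<subseteq> full_shift l" "X \<noteq> {}" "shift ` X = X" "compactin (seq_topology l) X"
    using assms(1) by (auto simp: two_sided_subshift_def)
  have compact: "compact (g ` X)" "compact (h ` X)"
    using compact_image_if_compactin[OF X(4)] assms(2,3) by auto
  obtain Mg where Mg: "\<And>x. x \<in> X \<Longrightarrow> \<bar>g x\<bar> \<le> Mg"
    using compact_imp_bounded[OF compact(1)] by (auto simp: bounded_iff)
  obtain Mh where Mh: "\<And>x. x \<in> X \<Longrightarrow> \<bar>h x\<bar> \<le> Mh"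
    using compact_imp_bounded[OF compact(2)] by (auto simp: bounded_iff)
  obtain x0 where x0: "x0 \<in> X" "\<And>x. x \<in> X \<Longrightarrow> h x \<le> h x0"
    using compact_attains_sup[OF compact(2)] X(2) by auto
  define c where "c = - h x0"
  interpret H: negative_potential l X h Mh c
    using X Mh x0 assms(4) by unfold_locales (auto simp: c_def)
  interpret F: bounded_potential l X f "Mg + \<bar>t\<bar> * Mh"
  proof
    fix x assume x: "x \<in> X"
    have "\<bar>f x\<bar> \<le> \<bar>g x\<bar> + \<bar>t\<bar> * \<bar>h x\<bar>"
      unfolding f_def by (metis abs_mult abs_triangle_ineq)
    also have "\<dots> \<le> Mg + \<bar>t\<bar> * Mh"
      by (intro add_mono mult_left_mono Mg Mh x) auto
    finally show "\<bar>f x\<bar> \<le> Mg + \<bar>t\<bar> * Mh" .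
  qed
  have pressure_0: "pressure X f = 0" using assms(5) by (simp add: f_def)
  have \<Gamma>_eq: "?\<Gamma> r = (\<Sum>w\<in>cut_words X h r. word_weight X f w)" for r
    by (simp add: Gamma_sum_def word_weight_def f_def)
  define N where "N = (\<lambda>r. nat \<lceil>- ln r / c\<rceil> + 1)"
  have N_lower: "- ln r / c + 1 \<le> real (N r)" for r
    unfolding N_def by linarith
  have N_upper: "real (N r) \<le> - ln r / c + 2" if "0 < r" "r < 1" for r
  proof -
    have "0 \<le> - ln r / c" using that H.c_pos by (intro divide_nonneg_pos) auto
    then show ?thesis unfolding N_def by linarith
  qed
  have cut_allowed: "cut_words X h r \<subseteq> allowed_words X" for r
    by (auto simp: H.cut_words_alt)
  have cut_length: "length w \<le> N r" if "w \<in> cut_words X h r" "0 < r" for w r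
    using H.cut_words_length[OF that] N_lower[of r] by linarith
  have \<Gamma>_ge_1: "1 \<le> ?\<Gamma> r" if r: "0 < r" "r < 1" for r
    unfolding \<Gamma>_eq
  proof (rule F.complete_prefix_set_weight_ge_1[OF pressure_0, of _ "N r"])
    fix w assume w: "w \<in> allowed_words X" "N r \<le> length w"
    have "- ln r < c * (- ln r / c + 1)"
      using H.c_pos by (simp add: field_simps)
    also have "\<dots> \<le> c * real (length w)"
      using w(2) N_lower[of r] H.c_pos by (intro mult_left_mono) auto
    finally have "exp (- c * real (length w)) < exp (ln r)" by simp
    then show "\<exists>k. take k w \<in> cut_words X h r"
      using r w(1) by (intro H.cut_words_complete) auto
  qed (use cut_allowed cut_length r in \<open>auto simp: H.cut_words_alt\<close>)
  have \<Gamma>_le: "?\<Gamma> r \<le> (\<Sum>n\<le>N r. partition_sum X f n)" if "0 < r" for r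
  proof -
    let ?S = "{w \<in> allowed_words X. length w \<le> N r}"
    have "?\<Gamma> r \<le> (\<Sum>w\<in>?S. word_weight X f w)"
      unfolding \<Gamma>_eq using cut_allowed cut_length[OF _ that]
      by (intro sum_mono2 H.finite_bounded_words) (auto intro: less_imp_le[OF F.word_weight_pos])
    also have "\<dots> = (\<Sum>n\<le>N r. \<Sum>w\<in>{w \<in> ?S. length w = n}. word_weight X f w)"
      by (rule sum.group[symmetric]) (auto intro: H.finite_bounded_words)
    also have "\<dots> = (\<Sum>n\<le>N r. partition_sum X f n)"
      unfolding partition_sum_def words_of_length_def
      by (intro sum.cong refl) auto
    finally show ?thesis .
  qed
  show ?thesis
  proof (rule tendstoI)
    fix e :: real assume e: "0 < e"
    \<comment> \<open>Below, \<open>2 * \<delta> * N r\<close> appears with \<open>N r\<close> close to \<open>- ln r / c\<close>; it becomes \<open>e / 2 * (- ln r)\<close>.\<close>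
    define \<delta> where "\<delta> = e * c / 4"
    have \<delta>: "0 < \<delta>" using e H.c_pos by (simp add: \<delta>_def)
    obtain K where K: "\<And>n. partition_sum X f n \<le> K * exp (\<delta> * real n)"
      using F.partition_sum_subexponential[OF pressure_0 \<delta>] by blast
    have K_pos: "0 < K" using F.partition_sum_pos[of 0] K[of 0] by simp
    define A where "A = ln (K / \<delta>) + 6 * \<delta>"
    have ln_\<Gamma>_le: "ln (?\<Gamma> r) \<le> A + e / 2 * (- ln r)" if r: "0 < r" "r < 1" for r
    proof -
      have "?\<Gamma> r \<le> (\<Sum>n\<le>N r. K * exp (\<delta> * real (N r)))"
      proof (rule order_trans[OF \<Gamma>_le[OF r(1)] sum_mono])
        fix n assume "n \<in> {..N r}"
        then have "K * exp (\<delta> * real n) \<le> K * exp (\<delta> * real (N r))"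
          using K_pos \<delta> by simp
        then show "partition_sum X f n \<le> K * exp (\<delta> * real (N r))"
          using K[of n] by linarith
      qed
      also have "\<dots> = K / \<delta> * (\<delta> * (real (N r) + 1)) * exp (\<delta> * real (N r))"
        using \<delta> by (simp add: field_simps)
      \<comment> \<open>The number \<open>N r + 1\<close> of lengths is absorbed by \<open>y \<le> exp y\<close>.\<close>
      also have "\<dots> \<le> K / \<delta> * exp (\<delta> * (real (N r) + 1)) * exp (\<delta> * (real (N r) + 1))"
      proof -
        have "\<delta> * (real (N r) + 1) \<le> exp (\<delta> * (real (N r) + 1))"
          using exp_ge_add_one_self[of "\<delta> * (real (N r) + 1)"] by linarith
        then show ?thesis
          using \<delta> K_pos by (intro mult_mono[OF mult_left_mono]) auto
      qed
      also have "\<dots> = K / \<delta> * exp (2 * \<delta> * (real (N r) + 1))"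
        by (simp add: mult_exp_exp algebra_simps)
      finally have "ln (?\<Gamma> r) \<le> ln (K / \<delta> * exp (2 * \<delta> * (real (N r) + 1)))"
        using \<Gamma>_ge_1[OF r] by (intro ln_mono) auto
      also have "\<dots> = ln (K / \<delta>) + 2 * \<delta> * (real (N r) + 1)"
        using K_pos \<delta> by (subst ln_mult_pos) auto
      also have "\<dots> \<le> ln (K / \<delta>) + 2 * \<delta> * (- ln r / c + 3)"
        using N_upper[OF r] \<delta> by simp
      also have "\<dots> = A + e / 2 * (- ln r)"
        using H.c_pos by (simp add: A_def \<delta>_def field_simps)
      finally show ?thesis .
    qed
    have "\<forall>\<^sub>F r in at_right 0. ln r < - (2 * \<bar>A\<bar> / e)"
      using ln_at_0 by (simp add: filterlim_at_bot_dense)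
    moreover have "\<forall>\<^sub>F r in at_right 0. 0 < r \<and> r < (1::real)"
      by (rule eventually_at_rightI[of 0 1]) auto
    ultimately show "\<forall>\<^sub>F r in at_right 0. dist (ln (?\<Gamma> r) / ln r) 0 < e"
    proof eventually_elim
      case (elim r)
      have neg: "ln r < 0" using elim(2) by simp
      have "\<bar>A\<bar> < e / 2 * (- ln r)" using elim(1) e by (simp add: field_simps)
      then have "ln (?\<Gamma> r) < e * (- ln r)"
        using ln_\<Gamma>_le[of r] elim(2) by (simp add: algebra_simps)
      moreover have "0 \<le> ln (?\<Gamma> r)" using \<Gamma>_ge_1[of r] elim(2) by simp
      ultimately show ?case using neg by (simp add: dist_real_def field_simps)
    qed
  qed
qed

end
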